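(* Let $k$ be a unique factorization domain of characteristic $p>0$, let $n,q\geq 1$ be integers and $h=x^n-y^q\in k[x,y]$. Suppose $\alpha:=\mathrm{val}_p(n)\geq 1$ and $\beta:=\mathrm{val}_p(q)\geq 1$, where $\mathrm{val}_p$ is the $p$-adic valuation. Put $\tau=\min\{\alpha,\beta\}\geq 1$, $s=n/p^\tau$, $t=q/p^\tau$ and $H=x^s-y^t$. Then for every $r\in\{1,2,3,\dots\}\cup\{\infty\}$ (with $rp^\tau=\infty$ if $r=\infty$), $$\mathrm{IDer}_k\bigl(k[x,y]/\langle h\rangle;rp^\tau\bigr)=\bigl\{\overline{\delta}\ \big|\ \delta\in\mathrm{IDer}_k(\log H;r)\bigr\},$$ where $\overline{\delta}$ denotes the $k$-derivation of $k[x,y]/\langle h\rangle$ induced by $\delta$. Moreover, the set of leaps of $k[x,y]/\langle h\rangle$ is $$\{rp^\tau\mid r\text{ is a leap of }k[x,y]/\langle H\rangle\}\cup\{p^\tau\}.$$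
   Context: For a commutative ring $k$ and a commutative $k$-algebra $A$, a Hasse-Schmidt derivation of $A$ over $k$ of length $m$ (an integer $m\geq 1$ or $m=\infty$) is a sequence $D=(D_0,D_1,\dots,D_m)$ (resp. $D=(D_0,D_1,\dots)$ if $m=\infty$) of $k$-linear maps $D_i:A\to A$ with $D_0=\mathrm{Id}_A$ and $D_i(xy)=\sum_{a+b=i}D_a(x)D_b(y)$ for all $x,y\in A$ and all $i$. The set of these is $\mathrm{HS}_k(A;m)$. The component $D_1$ is a $k$-derivation. $\mathrm{IDer}_k(A;m)$ is the set of $k$-derivations $\delta$ of $A$ such that there is $D\in\mathrm{HS}_k(A;m)$ with $D_1=\delta$. For an ideal $I\subseteq A$, $\mathrm{HS}_k(\log I;m)$ is the set of $D\in\mathrm{HS}_k(A;m)$ with $D_i(I)\subseteq I$ for all $i$, and $\mathrm{IDer}_k(\log I;m)$ is the set of $k$-derivations $\delta$ of $A$ such that there is $D\in\mathrm{HS}_k(\log I;m)$ with $D_1=\delta$. For $f\in A$, $\log f$ means $\log\langle f\rangle$. An algebra $A$ has a leap on an integer $s>1$ if the inclusion $\mathrm{IDer}_k(A;s-1)\supsetneq\mathrm{IDer}_k(A;s)$ is proper. *)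

theory Defs
  imports "HOL-Algebra.Algebra" "HOL-Algebra.Algebraic_Closure_Type"
    "HOL-Library.Extended_Nat" "HOL-Library.FuncSet"
begin

text \<open>
  A commutative \<open>k\<close>-algebra is given by a ring record \<open>A\<close> together with its structure map
  \<open>\<iota> :: 'k \<Rightarrow> 'a\<close>, where the base ring \<open>k\<close> is the type \<open>'k\<close>. Maps on an algebra are taken in the
  extensional function space, so that they are determined by their values on the carrier.
\<close>

definition linear_maps :: "('k \<Rightarrow> 'a) \<Rightarrow> ('a, 'b) ring_scheme \<Rightarrow> ('a \<Rightarrow> 'a) set" where
  "linear_maps \<iota> A = {d \<in> carrier A \<rightarrow>\<^sub>E carrier A.
     (\<forall>x\<in>carrier A. \<forall>y\<in>carrier A. d (x \<oplus>\<^bsub>A\<^esub> y) = d x \<oplus>\<^bsub>A\<^esub> d y) \<and>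
     (\<forall>c. \<forall>x\<in>carrier A. d (\<iota> c \<otimes>\<^bsub>A\<^esub> x) = \<iota> c \<otimes>\<^bsub>A\<^esub> d x)}"

definition derivations :: "('k \<Rightarrow> 'a) \<Rightarrow> ('a, 'b) ring_scheme \<Rightarrow> ('a \<Rightarrow> 'a) set" where
  "derivations \<iota> A = {d \<in> linear_maps \<iota> A.
     \<forall>x\<in>carrier A. \<forall>y\<in>carrier A. d (x \<otimes>\<^bsub>A\<^esub> y) = d x \<otimes>\<^bsub>A\<^esub> y \<oplus>\<^bsub>A\<^esub> x \<otimes>\<^bsub>A\<^esub> d y}"

text \<open>
  The length \<open>m\<close> is intended to be at least 1. A sequence of length \<open>m\<close> is indexed by the naturals
  \<open>i \<le> m\<close>, hence by all naturals if \<open>m = \<infinity>\<close>.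
\<close>

definition HS :: "('k \<Rightarrow> 'a) \<Rightarrow> ('a, 'b) ring_scheme \<Rightarrow> enat \<Rightarrow> (nat \<Rightarrow> 'a \<Rightarrow> 'a) set" where
  "HS \<iota> A m = {D \<in> {i. enat i \<le> m} \<rightarrow>\<^sub>E linear_maps \<iota> A.
     (\<forall>x\<in>carrier A. D 0 x = x) \<and>
     (\<forall>i. enat i \<le> m \<longrightarrow> (\<forall>x\<in>carrier A. \<forall>y\<in>carrier A.
        D i (x \<otimes>\<^bsub>A\<^esub> y) = (\<Oplus>\<^bsub>A\<^esub>a\<in>{..i}. D a x \<otimes>\<^bsub>A\<^esub> D (i - a) y)))}"

definition IDer :: "('k \<Rightarrow> 'a) \<Rightarrow> ('a, 'b) ring_scheme \<Rightarrow> enat \<Rightarrow> ('a \<Rightarrow> 'a) set" where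
  "IDer \<iota> A m = {\<delta> \<in> derivations \<iota> A. \<exists>D\<in>HS \<iota> A m. D 1 = \<delta>}"

definition HS_log ::
    "('k \<Rightarrow> 'a) \<Rightarrow> ('a, 'b) ring_scheme \<Rightarrow> 'a set \<Rightarrow> enat \<Rightarrow> (nat \<Rightarrow> 'a \<Rightarrow> 'a) set" where
  "HS_log \<iota> A I m = {D \<in> HS \<iota> A m. \<forall>i. enat i \<le> m \<longrightarrow> D i ` I \<subseteq> I}"

definition IDer_log ::
    "('k \<Rightarrow> 'a) \<Rightarrow> ('a, 'b) ring_scheme \<Rightarrow> 'a set \<Rightarrow> enat \<Rightarrow> ('a \<Rightarrow> 'a) set" where
  "IDer_log \<iota> A I m = {\<delta> \<in> derivations \<iota> A. \<exists>D\<in>HS_log \<iota> A I m. D 1 = \<delta>}"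

definition leaps :: "('k \<Rightarrow> 'a) \<Rightarrow> ('a, 'b) ring_scheme \<Rightarrow> nat set" where
  "leaps \<iota> A = {s. s > 1 \<and> IDer \<iota> A (enat s) \<subset> IDer \<iota> A (enat (s - 1))}"

definition quot_map :: "('k \<Rightarrow> 'a) \<Rightarrow> ('a, 'b) ring_scheme \<Rightarrow> 'a set \<Rightarrow> 'k \<Rightarrow> 'a set" where
  "quot_map \<iota> A I c = I +>\<^bsub>A\<^esub> \<iota> c"

text \<open>
  The map on \<open>A Quot I\<close> induced by \<open>\<delta>\<close>, sending \<open>I +> a\<close> to \<open>I +> \<delta> a\<close>. It is meaningful
  whenever \<open>\<delta>\<close> is additive with \<open>\<delta> ` I \<subseteq> I\<close>: then the image below is a singleton.
\<close>

definition induced :: "('a, 'b) ring_scheme \<Rightarrow> 'a set \<Rightarrow> ('a \<Rightarrow> 'a) \<Rightarrow> 'a set \<Rightarrow> 'a set" where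
  "induced A I \<delta> = (\<lambda>C\<in>carrier (A Quot I). the_elem ((\<lambda>a. I +>\<^bsub>A\<^esub> \<delta> a) ` C))"

text \<open>
  The type \<open>'k poly poly\<close> serves as \<open>k[x,y]\<close>: the inner variable is \<open>x\<close>, the outer one is \<open>y\<close>.
\<close>

abbreviation kxy :: "'k::comm_ring_1 poly poly ring" where
  "kxy \<equiv> ring_of_type_algebra"

definition const_xy :: "'k::comm_ring_1 \<Rightarrow> 'k poly poly" where
  "const_xy c = [:[:c:]:]"

definition var_x :: "'k::comm_ring_1 poly poly" where
  "var_x = [:[:0, 1:]:]"

definition var_y :: "'k::comm_ring_1 poly poly" where
  "var_y = [:0, 1:]"

abbreviation kxy_mod :: "'k::comm_ring_1 poly poly \<Rightarrow> 'k poly poly set ring" where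
  "kxy_mod f \<equiv> kxy Quot (PIdl\<^bsub>kxy\<^esub> f)"

abbreviation const_mod :: "'k::comm_ring_1 poly poly \<Rightarrow> 'k \<Rightarrow> 'k poly poly set" where
  "const_mod f \<equiv> quot_map const_xy kxy (PIdl\<^bsub>kxy\<^esub> f)"

end

theory Submission
  imports Defs
begin

text \<open>
  A Hasse-Schmidt derivation of \<open>k[x,y]\<close> of length \<open>m\<close> is the same as a \<open>k\<close>-algebra homomorphism
  \<open>\<phi>\<close> from \<open>k[x,y]\<close> to power series in one variable over \<open>k[x,y]\<close>, truncated after degree \<open>m\<close>,
  with constant term the identity. As \<open>k[x,y]\<close> is free, \<open>\<phi>\<close> is determined by the two series
  \<open>u = \<phi>(x)\<close> and \<open>v = \<phi>(y)\<close>, and these can be prescribed arbitrarily. For the same reason every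
  Hasse-Schmidt derivation of a quotient \<open>k[x,y]/\<langle>f\<rangle>\<close> lifts to such a substitution, which is then
  \<open>\<langle>f\<rangle>\<close>-logarithmic up to degree \<open>m\<close> (\<open>HS_imp_subst\<close>, \<open>HS_of_subst\<close>). Hence integrability questions
  for the quotient become divisibility questions about the coefficients of \<open>\<phi>(f)\<close>
  (\<open>IDer_log_eq\<close>, \<open>IDer_mod_eq_induced\<close>).

  Write \<open>P = p^\<tau>\<close>. In characteristic \<open>p\<close> one has \<open>h = H^P\<close>, so \<open>\<phi>(h) = \<phi>(H)^P\<close>, whose only
  coefficients that can be nonzero are the \<open>P\<close>-th powers \<open>D_i(H)^P\<close> in degrees \<open>i P\<close>. Moreover
  \<open>H^P\<close> divides \<open>a^P\<close> only if \<open>H\<close> divides \<open>a\<close>: the polynomial \<open>H\<close> is monic in \<open>y\<close> up to sign, so one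
  may replace \<open>a\<close> by its remainder modulo \<open>H\<close>, and then compare degrees. Therefore being
  logarithmic for \<open>h\<close> up to degree \<open>m\<close> means being logarithmic for \<open>H\<close> up to degree
  \<open>\<lfloor>m / P\<rfloor>\<close> (\<open>log_first_power\<close>). With \<open>m = r P\<close> this is the first claim.

  It also shows that \<open>k[x,y]/\<langle>h\<rangle>\<close> can leap only at multiples \<open>r P\<close>, and that a leap there compares the
  \<open>H\<close>-logarithmic derivations integrable up to \<open>r - 1\<close> and up to \<open>r\<close>, as derivations of
  \<open>k[x,y]/\<langle>h\<rangle>\<close>. For \<open>r > 1\<close> a leap of \<open>k[x,y]/\<langle>H\<rangle>\<close> at \<open>r\<close> compares the same two sets as
  derivations of \<open>k[x,y]/\<langle>H\<rangle>\<close>; nothing is lost in either quotient, since adding to a derivation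
  one with values in \<open>\<langle>H\<rangle>\<close> does not affect its logarithmic integrability (\<open>log_first_cong\<close>).
  For \<open>r = 1\<close> there always is a leap, because one of the partial derivatives of \<open>H\<close> is not
  divisible by \<open>H\<close> (\<open>curve_has_non_log_derivation\<close>): the prime \<open>p\<close> does not divide both exponents.
\<close>

section \<open>Substitution homomorphisms on \<open>k[x,y]\<close>\<close>

definition is_ring_hom :: "('a::comm_ring_1 \<Rightarrow> 'b::comm_ring_1) \<Rightarrow> bool" where
  "is_ring_hom c \<longleftrightarrow> c 1 = 1 \<and> (\<forall>a b. c (a + b) = c a + c b) \<and> (\<forall>a b. c (a * b) = c a * c b)"

lemma is_ring_hom_zero: "is_ring_hom c \<Longrightarrow> c 0 = 0"
  unfolding is_ring_hom_def by (metis add_cancel_right_right)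

lemma is_ring_hom_sum: "is_ring_hom c \<Longrightarrow> c (sum f A) = (\<Sum>a\<in>A. c (f a))"
  by (induction A rule: infinite_finite_induct) (auto simp: is_ring_hom_zero, auto simp: is_ring_hom_def)

lemma is_ring_hom_eval:
  assumes c: "is_ring_hom c"
  shows "is_ring_hom (\<lambda>g. poly (map_poly c g) u)"
proof -
  have 0: "c 0 = 0" using c by (rule is_ring_hom_zero)
  have 1: "map_poly c (f + g) = map_poly c f + map_poly c g" for f g
    by (intro poly_eqI) (use c in \<open>simp add: coeff_map_poly 0 is_ring_hom_def\<close>)
  have 2: "map_poly c (f * g) = map_poly c f * map_poly c g" for f g
    by (intro poly_eqI)
      (use c in \<open>simp add: coeff_map_poly 0 coeff_mult is_ring_hom_sum[OF c] is_ring_hom_def\<close>)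
  have 3: "map_poly c 1 = 1"
    by (intro poly_eqI) (use c in \<open>auto simp add: coeff_map_poly 0 is_ring_hom_def\<close>)
  show ?thesis unfolding is_ring_hom_def by (simp add: 1 2 3)
qed

text \<open>
  The coefficients of \<open>subst_xy u v g\<close> are the components \<open>D_0(g), D_1(g), \<dots>\<close> of a Hasse-Schmidt
  derivation whenever the constant terms of \<open>u\<close> and \<open>v\<close> are \<open>x\<close> and \<open>y\<close>. Full power series serve
  for every length: a finite length is a bound on the degrees that are looked at.
\<close>

definition subst_xy ::
    "'k::comm_ring_1 poly poly fps \<Rightarrow> 'k poly poly fps \<Rightarrow> 'k poly poly \<Rightarrow> 'k poly poly fps" where
  "subst_xy u v g =
     poly (map_poly (\<lambda>b. poly (map_poly (\<lambda>c. fps_const (const_xy c)) b) u) g) v"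

lemma is_ring_hom_const: "is_ring_hom (\<lambda>c. fps_const (const_xy c))"
  by (simp add: is_ring_hom_def const_xy_def flip: pCons_one)

lemma is_ring_hom_subst_xy: "is_ring_hom (subst_xy u v)"
  unfolding subst_xy_def by (intro is_ring_hom_eval is_ring_hom_const)

lemma subst_xy_add: "subst_xy u v (f + g) = subst_xy u v f + subst_xy u v g"
  and subst_xy_mult: "subst_xy u v (f * g) = subst_xy u v f * subst_xy u v g"
  and subst_xy_1: "subst_xy u v 1 = 1"
  using is_ring_hom_subst_xy[of u v] by (auto simp: is_ring_hom_def)

lemma subst_xy_0: "subst_xy u v 0 = 0"
  by (rule is_ring_hom_zero[OF is_ring_hom_subst_xy])

lemma subst_xy_diff: "subst_xy u v (f - g) = subst_xy u v f - subst_xy u v g"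
  using subst_xy_add[of u v "f - g" g] by (simp add: algebra_simps)

lemma subst_xy_power: "subst_xy u v (f ^ n) = subst_xy u v f ^ n"
  by (induction n) (simp_all add: subst_xy_1 subst_xy_mult)

lemma subst_xy_const: "subst_xy u v (const_xy c) = fps_const (const_xy c)"
  by (simp add: subst_xy_def const_xy_def map_poly_pCons)

lemma subst_xy_var_x: "subst_xy u v var_x = u"
  by (simp add: subst_xy_def var_x_def map_poly_pCons const_xy_def) (simp add: pCons_one)

lemma subst_xy_var_y: "subst_xy u v var_y = v"
  by (simp add: subst_xy_def var_y_def map_poly_pCons const_xy_def map_poly_1) (simp add: pCons_one)

lemmas subst_xy_simps = subst_xy_0 subst_xy_1 subst_xy_add subst_xy_diff subst_xy_mult
  subst_xy_power subst_xy_const subst_xy_var_x subst_xy_var_y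

lemma kxy_induct [case_names const var_x var_y add mult]:
  assumes const: "\<And>c. P (const_xy c)" and x: "P var_x" and y: "P var_y"
    and add: "\<And>f g. P f \<Longrightarrow> P g \<Longrightarrow> P (f + g)"
    and mult: "\<And>f g. P f \<Longrightarrow> P g \<Longrightarrow> P (f * g)"
  shows "P (f :: 'k::comm_ring_1 poly poly)"
proof (induction f)
  case 0
  show ?case using const[of 0] by (simp add: const_xy_def)
next
  case (pCons b g)
  have "P [:b:]"
  proof (induction b)
    case 0
    show ?case using const[of 0] by (simp add: const_xy_def)
  next
    case (pCons c b)
    have "[:pCons c b:] = const_xy c + var_x * [:b:]"
      by (simp add: const_xy_def var_x_def)
    then show ?case using add[OF const mult[OF x pCons.IH]] by metis
  qed
  moreover have "pCons b g = [:b:] + var_y * g"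
    by (simp add: var_y_def)
  ultimately show ?case using add[OF _ mult[OF y pCons.IH]] by metis
qed

lemma subst_xy_nth_0:
  assumes "u $ 0 = var_x" "v $ 0 = var_y"
  shows "subst_xy u v g $ 0 = g"
  by (induction g rule: kxy_induct) (simp_all add: subst_xy_simps assms)

lemma subst_xy_nth_1_cong:
  assumes "u $ 0 = var_x" "v $ 0 = var_y" "u' $ 0 = var_x" "v' $ 0 = var_y"
    and "u $ 1 = u' $ 1" "v $ 1 = v' $ 1"
  shows "subst_xy u v g $ 1 = subst_xy u' v' g $ 1"
  by (induction g rule: kxy_induct)
     (use assms in \<open>simp_all add: subst_xy_simps fps_mult_nth_1 subst_xy_nth_0\<close>)

lemma subst_xy_dvd_cong:
  assumes "F dvd u - u'" "F dvd v - v'"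
  shows "F dvd subst_xy u v g - subst_xy u' v' g"
proof (induction g rule: kxy_induct)
  case (add f g)
  then show ?case using dvd_add by (fastforce simp: subst_xy_simps algebra_simps)
next
  case (mult f g)
  have "subst_xy u v (f * g) - subst_xy u' v' (f * g) =
     (subst_xy u v f - subst_xy u' v' f) * subst_xy u v g +
     subst_xy u' v' f * (subst_xy u v g - subst_xy u' v' g)"
    by (simp add: subst_xy_simps algebra_simps)
  then show ?case using mult by simp
qed (use assms in \<open>simp_all add: subst_xy_simps\<close>)

section \<open>Hasse-Schmidt derivations as substitutions\<close>

lemma kxy_simps [simp]:
  "carrier kxy = UNIV" "f \<otimes>\<^bsub>kxy\<^esub> g = f * g" "f \<oplus>\<^bsub>kxy\<^esub> g = f + g" "\<one>\<^bsub>kxy\<^esub> = 1" "\<zero>\<^bsub>kxy\<^esub> = 0"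
  by (simp_all add: ring_of_type_algebra_def)

lemma cring_kxy: "cring (kxy :: 'k::comm_ring_1 poly poly ring)"
  by (rule cring_from_type_algebra)

lemma finsum_kxy:
  fixes f :: "'b \<Rightarrow> 'k::comm_ring_1 poly poly"
  shows "finite A \<Longrightarrow> (\<Oplus>\<^bsub>kxy\<^esub>a\<in>A. f a) = sum f A"
proof (induction A rule: finite_induct)
  case empty
  interpret cring "kxy :: 'k poly poly ring" by (rule cring_kxy)
  show ?case by simp
next
  case (insert a A)
  interpret cring "kxy :: 'k poly poly ring" by (rule cring_kxy)
  show ?case using insert by (subst finsum_insert) auto
qed

text \<open>
  Membership in \<^const>\<open>derivations\<close>, which \<^const>\<open>IDer\<close> and \<^const>\<open>IDer_log\<close> demand separately,
  is automatic for first components.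
\<close>

lemma HS_first_derivation:
  assumes B: "cring B" and D: "D \<in> HS \<iota> B m" and m: "1 \<le> m"
  shows "D 1 \<in> derivations \<iota> B"
proof -
  interpret cring B by (rule B)
  have lin: "D i \<in> linear_maps \<iota> B" if "enat i \<le> m" for i
    using D that by (auto simp: HS_def PiE_def)
  have m1: "enat 0 \<le> m" "enat 1 \<le> m" using m order_trans[OF _ m] by (simp_all add: one_enat_def)
  have cl: "D i z \<in> carrier B" if "i \<le> 1" "z \<in> carrier B" for i z
    using lin[of i] m1 that by (cases i) (auto simp: linear_maps_def PiE_def)
  have "D 1 (f \<otimes>\<^bsub>B\<^esub> g) = D 1 f \<otimes>\<^bsub>B\<^esub> g \<oplus>\<^bsub>B\<^esub> f \<otimes>\<^bsub>B\<^esub> D 1 g"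
    if fg: "f \<in> carrier B" "g \<in> carrier B" for f g
  proof -
    have "D 1 (f \<otimes>\<^bsub>B\<^esub> g) = (\<Oplus>\<^bsub>B\<^esub>a\<in>{..1}. D a f \<otimes>\<^bsub>B\<^esub> D (1 - a) g)"
      using D m1 fg unfolding HS_def by blast
    also have "{..1::nat} = {0, 1}" by auto
    also have "(\<Oplus>\<^bsub>B\<^esub>a\<in>{0, 1}. D a f \<otimes>\<^bsub>B\<^esub> D (1 - a) g) =
        D 0 f \<otimes>\<^bsub>B\<^esub> D 1 g \<oplus>\<^bsub>B\<^esub> D 1 f \<otimes>\<^bsub>B\<^esub> D 0 g"
      using cl fg by (subst finsum_insert) auto
    finally show ?thesis using D cl fg by (simp add: a_comm HS_def)
  qed
  then show ?thesis using lin[OF m1(2)] by (simp add: derivations_def)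
qed

text \<open>
  The polynomial ring itself and its quotients are treated together, as images of \<open>k[x,y]\<close> under
  a surjective homomorphism \<open>\<pi>\<close>.
\<close>

locale kxy_presentation =
  fixes \<pi> :: "'k::comm_ring_1 poly poly \<Rightarrow> 'b" and B :: "('b, 'c) ring_scheme"
  assumes cring_B: "cring B" and hom: "\<pi> \<in> ring_hom kxy B" and surj: "carrier B = range \<pi>"
begin

sublocale ring_hom_cring kxy B \<pi>
  by (intro ring_hom_cring.intro ring_hom_cring_axioms.intro cring_kxy cring_B hom)

lemma hom_add': "\<pi> (f + g) = \<pi> f \<oplus>\<^bsub>B\<^esub> \<pi> g"
  and hom_mult': "\<pi> (f * g) = \<pi> f \<otimes>\<^bsub>B\<^esub> \<pi> g"
  and hom_1': "\<pi> 1 = \<one>\<^bsub>B\<^esub>" and hom_0': "\<pi> 0 = \<zero>\<^bsub>B\<^esub>"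
  using hom_add[of f g] hom_mult[of f g] hom_one hom_zero by (simp_all)

lemma hom_fps_mult:
  "\<pi> ((F * G) $ i) = (\<Oplus>\<^bsub>B\<^esub>a\<in>{..i}. \<pi> (F $ a) \<otimes>\<^bsub>B\<^esub> \<pi> (G $ (i - a)))"
proof -
  have "\<pi> ((F * G) $ i) = \<pi> (\<Oplus>\<^bsub>kxy\<^esub>a\<in>{..i}. F $ a * G $ (i - a))"
    by (simp add: fps_mult_nth finsum_kxy atMost_atLeast0)
  also have "\<dots> = (\<Oplus>\<^bsub>B\<^esub>a\<in>{..i}. \<pi> (F $ a * G $ (i - a)))"
    by (subst hom_finsum) (auto simp: comp_def)
  finally show ?thesis by (simp add: hom_mult')
qed

text \<open>
  The components of a substitution descend along \<open>\<pi>\<close> to a Hasse-Schmidt derivation as soon as they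
  are well defined there, which is what the last hypothesis expresses.
\<close>

lemma HS_of_subst:
  assumes D: "\<And>i. enat i \<le> m \<Longrightarrow> D i \<in> extensional (carrier B)"
    and D': "\<And>i. \<not> enat i \<le> m \<Longrightarrow> D i = undefined"
    and uv: "u $ 0 = var_x" "v $ 0 = var_y"
    and eq: "\<And>i g. enat i \<le> m \<Longrightarrow> D i (\<pi> g) = \<pi> (subst_xy u v g $ i)"
  shows "D \<in> HS (\<pi> \<circ> const_xy) B m"
proof -
  have lin: "D i \<in> linear_maps (\<pi> \<circ> const_xy) B" if i: "enat i \<le> m" for i
    unfolding linear_maps_def PiE_def Pi_def surj
    using D[OF i] by (auto simp: eq[OF i] hom_add' [symmetric] hom_mult'[symmetric] surj
        subst_xy_simps intro!: eq[OF i, THEN trans])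
  have mult: "D i (\<pi> f \<otimes>\<^bsub>B\<^esub> \<pi> g) = (\<Oplus>\<^bsub>B\<^esub>a\<in>{..i}. D a (\<pi> f) \<otimes>\<^bsub>B\<^esub> D (i - a) (\<pi> g))"
    if i: "enat i \<le> m" for i f g
  proof -
    have le: "enat a \<le> m" if "a \<le> i" for a using i that order_trans enat_ord_simps(1) by blast
    have "D i (\<pi> f \<otimes>\<^bsub>B\<^esub> \<pi> g) = \<pi> ((subst_xy u v f * subst_xy u v g) $ i)"
      by (simp add: eq[OF i] subst_xy_simps flip: hom_mult')
    also have "\<dots> = (\<Oplus>\<^bsub>B\<^esub>a\<in>{..i}. D a (\<pi> f) \<otimes>\<^bsub>B\<^esub> D (i - a) (\<pi> g))"
      unfolding hom_fps_mult by (intro S.finsum_cong') (auto simp: eq le Pi_def surj simp flip: hom_mult')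
    finally show ?thesis .
  qed
  have zero: "D 0 (\<pi> g) = \<pi> g" for g
    using eq[of 0 g] by (simp add: subst_xy_nth_0 uv flip: zero_enat_def)
  show ?thesis
    unfolding HS_def using lin D' mult zero by (auto simp: PiE_def extensional_def surj)
qed

context
  fixes D m assumes D: "D \<in> HS (\<pi> \<circ> const_xy) B m"
begin

lemma HS_closed: "enat i \<le> m \<Longrightarrow> D i (\<pi> g) \<in> range \<pi>"
  using D by (auto simp: HS_def linear_maps_def PiE_def Pi_def surj)

lemma HS_add: "enat i \<le> m \<Longrightarrow> D i (\<pi> (f + g)) = D i (\<pi> f) \<oplus>\<^bsub>B\<^esub> D i (\<pi> g)"
  using D by (auto simp: HS_def linear_maps_def PiE_def Pi_def surj hom_add')

lemma HS_scale: "enat i \<le> m \<Longrightarrow> D i (\<pi> (const_xy c * g)) = \<pi> (const_xy c) \<otimes>\<^bsub>B\<^esub> D i (\<pi> g)"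
  using D by (auto simp: HS_def linear_maps_def PiE_def Pi_def surj hom_mult')

lemma HS_0: "D 0 (\<pi> g) = \<pi> g"
  using D by (auto simp: HS_def surj)

lemma HS_mult:
  assumes i: "enat i \<le> m"
    and F: "\<And>a. a \<le> i \<Longrightarrow> D a (\<pi> f) = \<pi> (F $ a)"
    and G: "\<And>a. a \<le> i \<Longrightarrow> D a (\<pi> g) = \<pi> (G $ a)"
  shows "D i (\<pi> (f * g)) = \<pi> ((F * G) $ i)"
proof -
  have "D i (\<pi> (f * g)) = (\<Oplus>\<^bsub>B\<^esub>a\<in>{..i}. D a (\<pi> f) \<otimes>\<^bsub>B\<^esub> D (i - a) (\<pi> g))"
    using D i by (auto simp: HS_def surj hom_mult')
  also have "\<dots> = \<pi> ((F * G) $ i)"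
    unfolding hom_fps_mult by (intro S.finsum_cong') (auto simp: F G Pi_def surj simp flip: hom_mult')
  finally show ?thesis .
qed

text \<open>
  Linearity over \<open>k\<close> reduces the values of \<open>D\<close> on constants to \<open>D_i(1)\<close>. The Leibniz rule for
  \<open>1 * 1\<close> gives \<open>D_i(1) = 2 D_i(1)\<close> for \<open>i > 0\<close> once the components strictly between \<open>0\<close> and \<open>i\<close>
  are known to kill \<open>1\<close>.
\<close>

lemma HS_one: "enat i \<le> m \<Longrightarrow> D i (\<pi> 1) = \<pi> ((1::'k poly poly fps) $ i)"
proof (induction i rule: less_induct)
  case (less i)
  show ?case
  proof (cases "i = 0")
    case True
    then show ?thesis by (simp add: HS_0)
  next
    case False
    obtain w where w: "D i (\<pi> 1) = \<pi> w" using HS_closed[OF less.prems] by blast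
    \<comment> \<open>\<open>F\<close> lifts \<open>D_0(1), \<dots>, D_i(1)\<close>, so the product rule turns into squaring \<open>F\<close>.\<close>
    define F :: "'k poly poly fps" where "F = 1 + fps_const w * fps_X ^ i"
    have "D a (\<pi> 1) = \<pi> (F $ a)" if "a \<le> i" for a
    proof (cases "a = i")
      case True
      then show ?thesis using w False by (simp add: F_def)
    next
      case neq: False
      then have "enat a \<le> m" using that less.prems order_trans enat_ord_simps(1) by blast
      then show ?thesis using less.IH[of a] neq that by (simp add: F_def)
    qed
    then have "\<pi> w = \<pi> ((F * F) $ i)"
      using HS_mult[OF less.prems, of 1 F 1 F] w by simp
    also have "F * F = 1 + fps_const (w + w) * fps_X ^ i + fps_const (w * w) * (fps_X ^ (i + i))"
      by (simp add: F_def algebra_simps power_add flip: fps_const_add fps_const_mult)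
    also have "\<dots> $ i = w + w" using False by (simp add: fps_X_power_nth)
    finally have "\<pi> w = \<pi> w \<oplus>\<^bsub>B\<^esub> \<pi> w" by (simp only: hom_add')
    moreover have "\<pi> w \<in> carrier B" by (simp add: surj)
    ultimately have "\<pi> w = \<zero>\<^bsub>B\<^esub>"
      using S.add.r_cancel_one' by metis
    then show ?thesis using w False by (simp add: hom_0')
  qed
qed

text \<open>
  Choose arbitrary preimages of the components of \<open>D\<close> on \<open>\<pi> x\<close> and \<open>\<pi> y\<close> as coefficients of
  \<open>u\<close> and \<open>v\<close>. Both sides of the equation are multiplicative systems that agree on constants and
  on the two variables, hence everywhere.
\<close>

lemma HS_imp_subst:
  obtains u v where "u $ 0 = var_x" "v $ 0 = var_y"
    "\<And>i g. enat i \<le> m \<Longrightarrow> D i (\<pi> g) = \<pi> (subst_xy u v g $ i)"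
proof -
  have ex: "\<exists>F. F $ 0 = g \<and> (\<forall>i. enat i \<le> m \<longrightarrow> D i (\<pi> g) = \<pi> (F $ i))" for g
  proof -
    have "\<forall>i. \<exists>w. (i = 0 \<longrightarrow> w = g) \<and> (enat i \<le> m \<longrightarrow> D i (\<pi> g) = \<pi> w)"
      using HS_closed HS_0 by (metis imageE)
    then obtain W where "\<forall>i. (i = 0 \<longrightarrow> W i = g) \<and> (enat i \<le> m \<longrightarrow> D i (\<pi> g) = \<pi> (W i))"
      by metis
    then show ?thesis by (intro exI[of _ "Abs_fps W"]) auto
  qed
  obtain u where u: "u $ 0 = var_x" "\<And>i. enat i \<le> m \<Longrightarrow> D i (\<pi> var_x) = \<pi> (u $ i)"
    using ex[of var_x] by blast
  obtain v where v: "v $ 0 = var_y" "\<And>i. enat i \<le> m \<Longrightarrow> D i (\<pi> var_y) = \<pi> (v $ i)"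
    using ex[of var_y] by blast
  have "\<forall>i. enat i \<le> m \<longrightarrow> D i (\<pi> g) = \<pi> (subst_xy u v g $ i)" for g
  proof (induction g rule: kxy_induct)
    case (const c)
    show ?case using HS_scale[of _ c 1]
      by (auto simp: HS_one subst_xy_simps simp flip: hom_mult')
  next
    case (mult f g)
    have le: "enat a \<le> m" if "a \<le> i" "enat i \<le> m" for a i :: nat
      using that order_trans enat_ord_simps(1) by blast
    show ?case using mult by (auto simp: subst_xy_simps intro!: HS_mult intro: le)
  next
    case (add f g)
    then show ?case by (auto simp: subst_xy_simps HS_add) (simp add: hom_add')
  qed (auto simp: u v subst_xy_simps)
  then show thesis using that[OF u(1) v(1)] by blast
qed

end

end

section \<open>Logarithmic derivations\<close>

text \<open>
  For \<open>r \<ge> 1\<close> these are the \<open>r\<close>-integrable \<open>f\<close>-logarithmic derivations (\<open>IDer_log_eq\<close> below).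
  For \<open>r = 0\<close> the divisibility holds trivially and all \<open>k\<close>-derivations of \<open>k[x,y]\<close> arise, which makes
  \<open>0\<close> a convenient starting point for the descending chain.
\<close>

definition log_first_components ::
    "'k::comm_ring_1 poly poly \<Rightarrow> enat \<Rightarrow> ('k poly poly \<Rightarrow> 'k poly poly) set" where
  "log_first_components f r = {(\<lambda>g. subst_xy u v g $ 1) | u v. u $ 0 = var_x \<and> v $ 0 = var_y \<and>
     (\<forall>i. enat i \<le> r \<longrightarrow> f dvd subst_xy u v f $ i)}"

lemma PIdl_kxy: "PIdl\<^bsub>kxy\<^esub> f = {g. f dvd g}"
  by (auto simp: cgenideal_def dvd_def mult.commute)

lemma rcoset_PIdl_kxy: "PIdl\<^bsub>kxy\<^esub> f +>\<^bsub>kxy\<^esub> a = {b. f dvd b - a}"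
proof -
  have "PIdl\<^bsub>kxy\<^esub> f +>\<^bsub>kxy\<^esub> a = (\<lambda>c. c + a) ` {g. f dvd g}"
    by (auto simp: PIdl_kxy a_r_coset_def r_coset_def)
  also have "\<dots> = {b. f dvd b - a}"
    by (auto intro: image_eqI[where x = "_ - a"])
  finally show ?thesis .
qed

lemma rcoset_eq_iff: "PIdl\<^bsub>kxy\<^esub> f +>\<^bsub>kxy\<^esub> a = PIdl\<^bsub>kxy\<^esub> f +>\<^bsub>kxy\<^esub> b \<longleftrightarrow> f dvd a - b"
proof
  assume "PIdl\<^bsub>kxy\<^esub> f +>\<^bsub>kxy\<^esub> a = PIdl\<^bsub>kxy\<^esub> f +>\<^bsub>kxy\<^esub> b"
  then show "f dvd a - b" unfolding rcoset_PIdl_kxy by (metis diff_self dvd_0_right mem_Collect_eq)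
next
  assume *: "f dvd a - b"
  have "f dvd c - a \<longleftrightarrow> f dvd c - b" for c
    using dvd_add_left_iff[OF *, of "c - a"] by simp
  then show "PIdl\<^bsub>kxy\<^esub> f +>\<^bsub>kxy\<^esub> a = PIdl\<^bsub>kxy\<^esub> f +>\<^bsub>kxy\<^esub> b" unfolding rcoset_PIdl_kxy by simp
qed

lemma presentation_id: "kxy_presentation (\<lambda>g. g) (kxy :: 'k::comm_ring_1 poly poly ring)"
  by (rule kxy_presentation.intro) (auto intro: cring_kxy ring_hom_memI)

lemma presentation_mod: "kxy_presentation ((+>\<^bsub>kxy\<^esub>) (PIdl\<^bsub>kxy\<^esub> f)) (kxy_mod f)"
proof -
  interpret cring "kxy :: 'a poly poly ring" by (rule cring_kxy)
  interpret ideal "PIdl\<^bsub>kxy\<^esub> f" kxy by (rule cgenideal_ideal) simp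
  show ?thesis
    by (intro kxy_presentation.intro quotient_is_cring cring_kxy rcos_ring_hom)
      (auto simp: FactRing_def A_RCOSETS_def RCOSETS_def a_r_coset_def)
qed

lemma const_mod_comp: "const_mod f = (+>\<^bsub>kxy\<^esub>) (PIdl\<^bsub>kxy\<^esub> f) \<circ> const_xy"
  by (auto simp: quot_map_def)

lemma carrier_kxy_mod: "carrier (kxy_mod f) = range ((+>\<^bsub>kxy\<^esub>) (PIdl\<^bsub>kxy\<^esub> f))"
  by (rule kxy_presentation.surj[OF presentation_mod])

lemma subst_xy_log:
  assumes "f dvd g" "\<And>a. a \<le> i \<Longrightarrow> f dvd subst_xy u v f $ a"
  shows "f dvd subst_xy u v g $ i"
  using assms by (auto simp: dvd_def[of f g] subst_xy_simps fps_mult_nth intro!: dvd_sum dvd_mult2)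

lemma enat_le_trans: "a \<le> i \<Longrightarrow> enat i \<le> m \<Longrightarrow> enat a \<le> m"
  using order_trans enat_ord_simps(1) by blast

lemma IDer_log_eq:
  assumes "1 \<le> r"
  shows "IDer_log const_xy kxy (PIdl\<^bsub>kxy\<^esub> f) r = log_first_components f r"
proof -
  interpret kxy_presentation "\<lambda>g. g" "kxy :: 'a poly poly ring" by (rule presentation_id)
  have c: "(\<lambda>g. g) \<circ> const_xy = const_xy" by auto
  have r1: "enat 1 \<le> r" using assms by (simp add: one_enat_def)
  show ?thesis
  proof (intro equalityI subsetI)
    fix \<delta> assume "\<delta> \<in> IDer_log const_xy kxy (PIdl\<^bsub>kxy\<^esub> f) r"
    then obtain D where D_log: "D \<in> HS_log const_xy kxy (PIdl\<^bsub>kxy\<^esub> f) r" and "D 1 = \<delta>"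
      unfolding IDer_log_def by blast
    then have D: "D \<in> HS const_xy kxy r" "D 1 = \<delta>" by (simp_all add: HS_log_def)
    have log: "D i f \<in> PIdl\<^bsub>kxy\<^esub> f" if "enat i \<le> r" for i
      using D_log that by (auto simp: HS_log_def PIdl_kxy image_subset_iff)
    obtain u v where "u $ 0 = var_x" "v $ 0 = var_y"
      and eq: "\<And>i g. enat i \<le> r \<Longrightarrow> D i g = subst_xy u v g $ i"
      using HS_imp_subst[unfolded c, OF D(1)] by blast
    moreover have "\<delta> = (\<lambda>g. subst_xy u v g $ 1)" using D(2) eq[OF r1] by auto
    ultimately show "\<delta> \<in> log_first_components f r"
      using log unfolding log_first_components_def PIdl_kxy by force
  next
    fix \<delta> assume "\<delta> \<in> log_first_components f r"
    then obtain u v where uv: "u $ 0 = var_x" "v $ 0 = var_y"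
      and log: "\<And>i. enat i \<le> r \<Longrightarrow> f dvd subst_xy u v f $ i"
      and \<delta>: "\<delta> = (\<lambda>g. subst_xy u v g $ 1)"
      by (auto simp: log_first_components_def)
    define D where "D i = (if enat i \<le> r then (\<lambda>g. subst_xy u v g $ i) else undefined)" for i
    have D: "D \<in> HS const_xy kxy r"
      by (rule HS_of_subst[unfolded c, OF _ _ uv]) (auto simp: D_def)
    have "D \<in> HS_log const_xy kxy (PIdl\<^bsub>kxy\<^esub> f) r"
      using D by (auto simp: HS_log_def PIdl_kxy D_def intro: subst_xy_log log enat_le_trans)
    moreover have "D 1 = \<delta>" using r1 by (simp add: D_def \<delta>)
    ultimately show "\<delta> \<in> IDer_log const_xy kxy (PIdl\<^bsub>kxy\<^esub> f) r"
      using HS_first_derivation[OF cring_kxy D assms] unfolding IDer_log_def by blast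
  qed
qed

lemma induced_rcoset:
  assumes "\<And>a b. f dvd a - b \<Longrightarrow> f dvd \<delta> a - \<delta> b"
  shows "induced kxy (PIdl\<^bsub>kxy\<^esub> f) \<delta> (PIdl\<^bsub>kxy\<^esub> f +>\<^bsub>kxy\<^esub> a) = PIdl\<^bsub>kxy\<^esub> f +>\<^bsub>kxy\<^esub> \<delta> a"
proof -
  let ?q = "(+>\<^bsub>kxy\<^esub>) (PIdl\<^bsub>kxy\<^esub> f)"
  have "(\<lambda>b. ?q (\<delta> b)) ` ?q a = {?q (\<delta> a)}"
  proof -
    have "?q (\<delta> b) = ?q (\<delta> a)" if "b \<in> ?q a" for b
      using that assms by (simp add: rcoset_eq_iff) (simp add: rcoset_PIdl_kxy)
    moreover have "a \<in> ?q a" by (simp add: rcoset_PIdl_kxy)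
    ultimately show ?thesis by blast
  qed
  then show ?thesis by (simp add: induced_def carrier_kxy_mod)
qed

lemma induced_subst:
  assumes "\<And>a. a \<le> i \<Longrightarrow> f dvd subst_xy u v f $ a"
  shows "induced kxy (PIdl\<^bsub>kxy\<^esub> f) (\<lambda>g. subst_xy u v g $ i) (PIdl\<^bsub>kxy\<^esub> f +>\<^bsub>kxy\<^esub> g) =
    PIdl\<^bsub>kxy\<^esub> f +>\<^bsub>kxy\<^esub> subst_xy u v g $ i"
proof (rule induced_rcoset)
  fix a b assume "f dvd a - b"
  then have "f dvd subst_xy u v (a - b) $ i" using assms by (rule subst_xy_log)
  then show "f dvd subst_xy u v a $ i - subst_xy u v b $ i" by (simp add: subst_xy_diff)
qed

lemma induced_extensional: "induced A I \<delta> \<in> extensional (carrier (A Quot I))"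
  by (simp add: induced_def)

lemma IDer_mod_eq_induced:
  assumes "1 \<le> m"
  shows "IDer (const_mod f) (kxy_mod f) m = induced kxy (PIdl\<^bsub>kxy\<^esub> f) ` log_first_components f m"
proof -
  let ?q = "(+>\<^bsub>kxy\<^esub>) (PIdl\<^bsub>kxy\<^esub> f)"
  interpret kxy_presentation ?q "kxy_mod f" by (rule presentation_mod)
  have m1: "enat 1 \<le> m" using assms by (simp add: one_enat_def)
  show ?thesis
  proof (intro equalityI subsetI)
    fix \<delta> assume "\<delta> \<in> IDer (const_mod f) (kxy_mod f) m"
    then obtain D where D: "D \<in> HS (?q \<circ> const_xy) (kxy_mod f) m" "D 1 = \<delta>"
      by (auto simp: IDer_def const_mod_comp)
    obtain u v where uv: "u $ 0 = var_x" "v $ 0 = var_y"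
      and eq: "\<And>i g. enat i \<le> m \<Longrightarrow> D i (?q g) = ?q (subst_xy u v g $ i)"
      using HS_imp_subst[OF D(1)] by blast
    have f0: "?q f = ?q 0" by (simp add: rcoset_eq_iff)
    have log: "f dvd subst_xy u v f $ i" if "enat i \<le> m" for i
      using eq[OF that, of f] eq[OF that, of 0] unfolding f0
      by (simp add: rcoset_eq_iff subst_xy_0)
    have "\<delta> = induced kxy (PIdl\<^bsub>kxy\<^esub> f) (\<lambda>g. subst_xy u v g $ 1)"
    proof (rule extensionalityI[OF _ induced_extensional])
      show "\<delta> \<in> extensional (carrier (kxy_mod f))"
        using D m1 by (auto simp: HS_def linear_maps_def PiE_def Pi_def)
      fix C assume "C \<in> carrier (kxy_mod f)"
      then obtain g where "C = ?q g" by (auto simp: carrier_kxy_mod)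
      then show "\<delta> C = induced kxy (PIdl\<^bsub>kxy\<^esub> f) (\<lambda>g. subst_xy u v g $ 1) C"
        using eq[OF m1] D(2) by (simp add: induced_subst log enat_le_trans[OF _ m1])
    qed
    then show "\<delta> \<in> induced kxy (PIdl\<^bsub>kxy\<^esub> f) ` log_first_components f m"
      using uv log by (auto simp: log_first_components_def)
  next
    fix \<delta> assume "\<delta> \<in> induced kxy (PIdl\<^bsub>kxy\<^esub> f) ` log_first_components f m"
    then obtain u v where uv: "u $ 0 = var_x" "v $ 0 = var_y"
      and log: "\<And>i. enat i \<le> m \<Longrightarrow> f dvd subst_xy u v f $ i"
      and \<delta>: "\<delta> = induced kxy (PIdl\<^bsub>kxy\<^esub> f) (\<lambda>g. subst_xy u v g $ 1)"
      by (auto simp: log_first_components_def)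
    define D where "D i = (if enat i \<le> m then induced kxy (PIdl\<^bsub>kxy\<^esub> f) (\<lambda>g. subst_xy u v g $ i)
      else undefined)" for i
    have D: "D \<in> HS (?q \<circ> const_xy) (kxy_mod f) m"
    proof (rule HS_of_subst[OF _ _ uv])
      show "D i (?q g) = ?q (subst_xy u v g $ i)" if "enat i \<le> m" for i g
        using that by (simp add: D_def induced_subst log enat_le_trans[OF _ that])
    qed (auto simp: D_def induced_extensional)
    moreover have "D 1 = \<delta>" using m1 by (simp add: D_def \<delta>)
    ultimately show "\<delta> \<in> IDer (const_mod f) (kxy_mod f) m"
      using HS_first_derivation[OF cring_B D assms] unfolding IDer_def const_mod_comp by blast
  qed
qed

lemma log_first_antimono: "r \<le> r' \<Longrightarrow> log_first_components f r' \<subseteq> log_first_components f r"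
  unfolding log_first_components_def by (blast intro: order_trans)

lemma fps_const_dvd_nth: "fps_const a dvd F \<Longrightarrow> a dvd F $ i"
  by (auto simp: dvd_def)

text \<open>
  Take a substitution that integrates \<open>\<delta>'\<close> and shift its linear coefficients by the values of
  \<open>\<delta> - \<delta>'\<close> on \<open>x\<close> and \<open>y\<close>. The first component becomes \<open>\<delta>\<close>, while modulo \<open>H\<close> the substitution
  does not change, so it stays logarithmic.
\<close>

lemma log_first_cong:
  assumes 1: "\<delta> \<in> log_first_components f a" and 2: "\<delta>' \<in> log_first_components H r"
    and cong: "\<And>g. H dvd \<delta> g - \<delta>' g"
  shows "\<delta> \<in> log_first_components H r"
proof -
  obtain u v where uv: "u $ 0 = var_x" "v $ 0 = var_y" and \<delta>: "\<delta> = (\<lambda>g. subst_xy u v g $ 1)"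
    using 1 by (auto simp: log_first_components_def)
  obtain u' v' where uv': "u' $ 0 = var_x" "v' $ 0 = var_y" and \<delta>': "\<delta>' = (\<lambda>g. subst_xy u' v' g $ 1)"
    and log: "\<And>i. enat i \<le> r \<Longrightarrow> H dvd subst_xy u' v' H $ i"
    using 2 by (auto simp: log_first_components_def)
  define U where "U = u' + fps_const (\<delta> var_x - \<delta>' var_x) * fps_X"
  define V where "V = v' + fps_const (\<delta> var_y - \<delta>' var_y) * fps_X"
  have UV: "U $ 0 = var_x" "V $ 0 = var_y" by (simp_all add: U_def V_def uv')
  have "U $ 1 = u $ 1" "V $ 1 = v $ 1"
    by (simp_all add: U_def V_def \<delta> \<delta>' subst_xy_var_x subst_xy_var_y)
  then have eq: "\<delta> = (\<lambda>g. subst_xy U V g $ 1)"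
    unfolding \<delta> by (intro ext subst_xy_nth_1_cong uv UV) simp_all
  have c: "fps_const H dvd fps_const (\<delta> g - \<delta>' g) * fps_X" for g
  proof -
    obtain w where "\<delta> g - \<delta>' g = H * w" using cong[of g] by (rule dvdE)
    then have "fps_const (\<delta> g - \<delta>' g) * fps_X = fps_const H * (fps_const w * fps_X)"
      by (simp add: mult.assoc flip: fps_const_mult)
    then show ?thesis by (rule dvdI)
  qed
  have "fps_const H dvd subst_xy U V H - subst_xy u' v' H"
    by (rule subst_xy_dvd_cong) (simp_all add: U_def V_def c)
  then have diff: "H dvd subst_xy U V H $ i - subst_xy u' v' H $ i" for i
    using fps_const_dvd_nth[of H _ i] by fastforce
  have "H dvd subst_xy U V H $ i" if "enat i \<le> r" for i
    using dvd_add[OF diff[of i] log[OF that]] by simp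
  then show ?thesis unfolding log_first_components_def eq using UV by blast
qed

text \<open>
  Derivations that induce the same map modulo \<open>f\<close> are congruent modulo \<open>H\<close>, so \<open>log_first_cong\<close>
  allows comparing integrable derivations upstairs. The inclusions into
  \<^term>\<open>log_first_components f 1\<close> make sure that the derivations do induce maps on the quotient.
\<close>

lemma induced_log_first_subset_iff:
  assumes "H dvd f"
    and log: "log_first_components H r \<subseteq> log_first_components f 1"
      "log_first_components H r' \<subseteq> log_first_components f 1"
  shows "induced kxy (PIdl\<^bsub>kxy\<^esub> f) ` log_first_components H r \<subseteq>
      induced kxy (PIdl\<^bsub>kxy\<^esub> f) ` log_first_components H r' \<longleftrightarrow>
    log_first_components H r \<subseteq> log_first_components H r'"
    (is "?ind ` ?A \<subseteq> ?ind ` ?B \<longleftrightarrow> _")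
proof
  assume sub: "?ind ` ?A \<subseteq> ?ind ` ?B"
  have ind: "?ind \<delta> (PIdl\<^bsub>kxy\<^esub> f +>\<^bsub>kxy\<^esub> g) = PIdl\<^bsub>kxy\<^esub> f +>\<^bsub>kxy\<^esub> \<delta> g"
    if "\<delta> \<in> log_first_components f 1" for \<delta> g
  proof -
    obtain u v where \<delta>: "\<delta> = (\<lambda>g. subst_xy u v g $ 1)"
      and log: "\<And>i. enat i \<le> 1 \<Longrightarrow> f dvd subst_xy u v f $ i"
      using \<open>\<delta> \<in> log_first_components f 1\<close> by (auto simp: log_first_components_def)
    show ?thesis unfolding \<delta> by (rule induced_subst) (simp add: log one_enat_def)
  qed
  show "?A \<subseteq> ?B"
  proof
    fix \<delta> assume \<delta>: "\<delta> \<in> ?A"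
    then obtain \<delta>' where \<delta>': "\<delta>' \<in> ?B" "?ind \<delta> = ?ind \<delta>'"
      using sub by blast
    have f1: "\<delta> \<in> log_first_components f 1" "\<delta>' \<in> log_first_components f 1" using \<delta> \<delta>'(1) log by auto
    have "H dvd \<delta> g - \<delta>' g" for g
    proof -
      have "PIdl\<^bsub>kxy\<^esub> f +>\<^bsub>kxy\<^esub> \<delta> g = PIdl\<^bsub>kxy\<^esub> f +>\<^bsub>kxy\<^esub> \<delta>' g"
        using \<delta>'(2) by (simp flip: ind[OF f1(1)] ind[OF f1(2)])
      then show ?thesis using \<open>H dvd f\<close> dvd_trans unfolding rcoset_eq_iff by blast
    qed
    then show "\<delta> \<in> ?B" by (rule log_first_cong[OF f1(1) \<delta>'(1)])
  qed
qed blast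

section \<open>Frobenius powers\<close>

lemma prime_power_char_diff:
  fixes a b :: "'a::comm_ring_1"
  assumes "Factorial_Ring.prime CHAR('a)" "P = CHAR('a) ^ k"
  shows "(a - b) ^ P = a ^ P - b ^ P"
  using freshmans_dream'[OF assms, of "a - b" b] by (simp add: algebra_simps)

text \<open>
  A given coefficient sees only a polynomial part of \<open>F\<close>, to which additivity of the Frobenius
  map applies termwise.
\<close>

lemma fps_frobenius_nth:
  fixes F :: "'a::comm_ring_1 fps"
  assumes "Factorial_Ring.prime CHAR('a)" "P = CHAR('a) ^ k"
  shows "(F ^ P) $ m = (if P dvd m then (F $ (m div P)) ^ P else 0)"
proof -
  have P: "P > 0" using assms by (simp add: prime_gt_0_nat)
  have char: "Factorial_Ring.prime CHAR('a fps)" "P = CHAR('a fps) ^ k" using assms by simp_all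
  define G where "G = (\<Sum>i\<le>m. fps_const (F $ i) * fps_X ^ i)"
  define R where "R = fps_shift (Suc m) F"
  have "F = G + fps_X ^ Suc m * R"
  proof (rule fps_ext)
    fix j
    have "G $ j = (if j \<le> m then F $ j else 0)"
      by (simp add: G_def fps_sum_nth fps_X_power_nth if_distrib[of "(*) _"] sum.delta cong: if_cong)
    then show "F $ j = (G + fps_X ^ Suc m * R) $ j"
      by (auto simp: R_def fps_X_power_mult_nth simp del: power_Suc)
  qed
  then have "F ^ P = G ^ P + (fps_X ^ Suc m * R) ^ P"
    using freshmans_dream'[OF char] by simp
  also have "(fps_X ^ Suc m * R) ^ P = fps_X ^ (Suc m * P) * R ^ P"
    by (simp only: power_mult_distrib power_mult)
  also have "G ^ P = (\<Sum>i\<le>m. fps_const ((F $ i) ^ P) * fps_X ^ (i * P))"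
    unfolding G_def freshmans_dream_sum'[OF char] by (simp add: power_mult_distrib fps_const_power power_mult)
  moreover have "m < Suc m * P" using P by (cases P) auto
  ultimately have "(F ^ P) $ m = (\<Sum>i\<le>m. if m = i * P then (F $ i) ^ P else 0)"
    by (simp add: fps_sum_nth fps_X_power_nth fps_X_power_mult_nth
        if_distrib[of "(*) _"] del: power_Suc mult_Suc cong: if_cong)
  also have "\<dots> = (if P dvd m then (F $ (m div P)) ^ P else 0)"
  proof (cases "P dvd m")
    case True
    then obtain l where l: "m = l * P" by (auto simp: dvd_def mult.commute)
    have "l \<le> m" using P l by simp
    have "(\<Sum>i\<le>m. if m = i * P then (F $ i) ^ P else 0) = (\<Sum>i\<le>m. if i = l then (F $ i) ^ P else 0)"
      using P l by (intro sum.cong) auto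
    then show ?thesis using l P \<open>l \<le> m\<close> by simp
  next
    case False
    then show ?thesis by (auto intro!: sum.neutral)
  qed
  finally show ?thesis .
qed

text \<open>
  Let \<open>R\<close> be the remainder of \<open>a\<close> modulo \<open>f\<close>. By additivity of the Frobenius map \<open>f ^ P\<close> divides
  \<open>R ^ P\<close>, which has smaller degree, so \<open>R = 0\<close>.
\<close>

lemma frobenius_dvd_imp_dvd:
  fixes f a :: "'a::idom poly"
  assumes P: "Factorial_Ring.prime CHAR('a)" "P = CHAR('a) ^ k"
    and lc: "lead_coeff f dvd 1" and dvd: "f ^ P dvd a ^ P"
  shows "f dvd a"
proof -
  have Ppos: "P > 0" using P by (simp add: prime_gt_0_nat)
  have f0: "f \<noteq> 0" using lc by auto
  obtain q r where qr: "pseudo_divmod a f = (q, r)" by force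
  define n where "n = Suc (degree a) - degree f"
  obtain d where d: "lead_coeff f * d = 1" using lc by (auto simp: dvd_def)
  have "smult (lead_coeff f ^ n) a = f * q + r" and r: "r = 0 \<or> degree r < degree f"
    using pseudo_divmod[OF f0 qr] by (auto simp: n_def)
  \<comment> \<open>Cancelling the unit leading coefficient turns pseudo-division into division with remainder.\<close>
  then have "smult (d ^ n) (smult (lead_coeff f ^ n) a) = f * smult (d ^ n) q + smult (d ^ n) r"
    by (simp add: smult_add_right)
  then have a: "a = f * smult (d ^ n) q + smult (d ^ n) r"
    using d by (simp add: mult.commute flip: power_mult_distrib)
  define R where "R = smult (d ^ n) r"
  have char: "Factorial_Ring.prime CHAR('a poly)" "P = CHAR('a poly) ^ k" using P by simp_all
  have "a ^ P = (f * smult (d ^ n) q) ^ P + R ^ P"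
    using freshmans_dream'[OF char, of "f * smult (d ^ n) q" R] a by (simp add: R_def)
  then have "f ^ P dvd R ^ P"
    using dvd dvd_add_right_iff[of "f ^ P" "(f * smult (d ^ n) q) ^ P" "R ^ P"]
    by (simp only: power_mult_distrib dvd_triv_left)
  moreover have "degree R < degree f \<or> R = 0" using r degree_smult_le[of "d ^ n" r] unfolding R_def by auto
  ultimately have "R = 0"
    using dvd_imp_degree_le[of "f ^ P" "R ^ P"] Ppos
    by (cases "R = 0") (simp_all add: degree_power_eq f0)
  then have "a = f * smult (d ^ n) q" using a by (simp add: R_def)
  then show ?thesis by (rule dvdI)
qed

text \<open>
  The hypothesis on \<open>m\<close> and \<open>r\<close> says that \<open>r\<close> is the integral part of \<open>m / P\<close>, in a form that
  covers infinite lengths as well.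
\<close>

lemma log_first_power:
  fixes H :: "'k::idom poly poly"
  assumes P: "Factorial_Ring.prime CHAR('k)" "P = CHAR('k) ^ k" and lc: "lead_coeff H dvd 1"
    and mr: "\<And>i. enat (i * P) \<le> m \<longleftrightarrow> enat i \<le> r"
  shows "log_first_components (H ^ P) m = log_first_components H r"
proof -
  have Ppos: "P > 0" using P by (simp add: prime_gt_0_nat)
  have iff: "H ^ P dvd a ^ P \<longleftrightarrow> H dvd a" for a
    using frobenius_dvd_imp_dvd[of P k H a] P lc by (auto simp: dvd_power_same)
  have "(\<forall>j. enat j \<le> m \<longrightarrow> H ^ P dvd subst_xy u v (H ^ P) $ j) \<longleftrightarrow>
        (\<forall>i. enat i \<le> r \<longrightarrow> H dvd subst_xy u v H $ i)" (is "?L \<longleftrightarrow> ?R") for u v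
  proof -
    have nth: "subst_xy u v (H ^ P) $ j =
        (if P dvd j then (subst_xy u v H $ (j div P)) ^ P else 0)" for j
      unfolding subst_xy_power by (rule fps_frobenius_nth[where k = k]) (use P in simp_all)
    show ?thesis
    proof
      assume ?L
      then have "H ^ P dvd subst_xy u v (H ^ P) $ (i * P)" if "enat i \<le> r" for i
        using that mr by blast
      then show ?R using Ppos by (simp add: nth iff)
    next
      assume R: ?R
      show ?L
      proof (intro allI impI)
        fix j assume "enat j \<le> m"
        then show "H ^ P dvd subst_xy u v (H ^ P) $ j"
          using R mr[of "j div P"] by (auto simp: nth iff)
      qed
    qed
  qed
  then show ?thesis unfolding log_first_components_def by simp
qed

section \<open>The curve \<open>x^s - y^t\<close>\<close>

lemma fps_power_nth_1: "(F ^ n) $ 1 = of_nat n * (F $ 0) ^ (n - 1) * F $ 1"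
  for F :: "'a::comm_ring_1 fps"
proof (induction n)
  case (Suc n)
  then show ?case by (cases n) (simp_all add: fps_mult_nth_1 fps_power_zeroth algebra_simps)
qed simp

lemma degree_curve:
  assumes "t \<ge> 1" "H = var_x ^ s - var_y ^ t"
  shows "degree (H :: 'k::idom poly poly) = t" "lead_coeff H = - 1"
proof -
  have y: "var_y ^ t = (monom 1 t :: 'k poly poly)" by (simp add: var_y_def monom_altdef)
  have x: "degree (var_x ^ s :: 'k poly poly) = 0"
    using degree_power_le[of "var_x :: 'k poly poly" s] by (simp add: var_x_def)
  show deg: "degree H = t"
    using degree_add_eq_right[of "var_x ^ s" "- monom 1 t :: 'k poly poly"] assms(1) x
    by (simp add: assms(2) y degree_monom_eq)
  show "lead_coeff H = - 1"
    unfolding deg using assms(1) x by (simp add: assms(2) y coeff_eq_0)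
qed

text \<open>
  The partial derivatives \<open>s x^(s-1)\<close> and \<open>- t y^(t-1)\<close> have smaller degree in \<open>y\<close> than \<open>H\<close>. If all
  derivations were \<open>H\<close>-logarithmic, both would therefore vanish, and the characteristic would
  divide both exponents.
\<close>

lemma curve_has_non_log_derivation:
  fixes H :: "'k::idom poly poly"
  assumes t: "t \<ge> 1" and H: "H = var_x ^ s - var_y ^ t"
    and st: "\<not> (CHAR('k) dvd s \<and> CHAR('k) dvd t)"
  shows "\<not> log_first_components H 0 \<subseteq> log_first_components H 1"
proof
  assume sub: "log_first_components H 0 \<subseteq> log_first_components H 1"
  have dvd: "H dvd subst_xy u v H $ 1" if uv: "u $ 0 = var_x" "v $ 0 = var_y" for u v
  proof -
    have "(\<lambda>g. subst_xy u v g $ 1) \<in> log_first_components H 0"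
      unfolding log_first_components_def
      by (intro CollectI exI[of _ u] exI[of _ v]) (use uv in \<open>auto simp: zero_enat_def subst_xy_nth_0\<close>)
    then have "(\<lambda>g. subst_xy u v g $ 1) \<in> log_first_components H 1" using sub by blast
    then obtain u' v' where "(\<lambda>g. subst_xy u v g $ 1) = (\<lambda>g. subst_xy u' v' g $ 1)"
      and "\<forall>i. enat i \<le> 1 \<longrightarrow> H dvd subst_xy u' v' H $ i"
      unfolding log_first_components_def by blast
    then show ?thesis unfolding one_enat_def by (metis order_refl)
  qed
  have deg: "degree H = t" using degree_curve[OF t H] by simp
  have "degree (var_x ^ (s - 1) :: 'k poly poly) = 0"
    using degree_power_le[of "var_x :: 'k poly poly" "s - 1"] by (simp add: var_x_def)
  moreover have "degree (of_nat s :: 'k poly poly) = 0" by (simp add: of_nat_poly)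
  ultimately have "degree (of_nat s * var_x ^ (s - 1) :: 'k poly poly) < degree H"
    using degree_mult_le[of "of_nat s" "var_x ^ (s - 1) :: 'k poly poly"] t deg by linarith
  moreover have "H dvd of_nat s * var_x ^ (s - 1)"
    using dvd[of "fps_const var_x + fps_X" "fps_const var_y"]
    by (simp add: H subst_xy_simps fps_power_nth_1[unfolded One_nat_def])
  ultimately have s0: "of_nat s * var_x ^ (s - 1) = (0 :: 'k poly poly)"
    using dvd_imp_degree_le leD by blast
  have "degree (var_y ^ (t - 1) :: 'k poly poly) \<le> t - 1"
    using degree_power_le[of "var_y :: 'k poly poly" "t - 1"] by (simp add: var_y_def)
  moreover have "degree (of_nat t :: 'k poly poly) = 0" by (simp add: of_nat_poly)
  ultimately have "degree (of_nat t * var_y ^ (t - 1) :: 'k poly poly) < degree H"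
    using degree_mult_le[of "of_nat t" "var_y ^ (t - 1) :: 'k poly poly"] t deg by linarith
  moreover have "H dvd of_nat t * var_y ^ (t - 1)"
    using dvd[of "fps_const var_x" "fps_const var_y + fps_X"]
    by (simp add: H subst_xy_simps fps_power_nth_1[unfolded One_nat_def])
  ultimately have t0: "of_nat t * var_y ^ (t - 1) = (0 :: 'k poly poly)"
    using dvd_imp_degree_le leD by blast
  have "CHAR('k) dvd s" "CHAR('k) dvd t"
    using s0 t0 of_nat_eq_0_iff_char_dvd[where 'a = "'k poly poly"]
    by (simp_all add: var_x_def var_y_def)
  then show False using st by blast
qed

theorem proposition2p13:
  fixes p n q \<alpha> \<beta> \<tau> s t :: nat
    and h H :: "'k::idom poly poly"
  assumes ufd: "factorial_domain (ring_of_type_algebra :: 'k ring)"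
    and char: "CHAR('k) = p" "p > 0"
    and nq: "n \<ge> 1" "q \<ge> 1"
    and h_def: "h = var_x ^ n - var_y ^ q"
    and \<alpha>_def: "\<alpha> = multiplicity p n" and \<alpha>_pos: "\<alpha> \<ge> 1"
    and \<beta>_def: "\<beta> = multiplicity p q" and \<beta>_pos: "\<beta> \<ge> 1"
    and \<tau>_def: "\<tau> = min \<alpha> \<beta>"
    and s_def: "s = n div p ^ \<tau>"
    and t_def: "t = q div p ^ \<tau>"
    and H_def: "H = var_x ^ s - var_y ^ t"
  shows "(\<forall>r::enat. r \<ge> 1 \<longrightarrow>
            IDer (const_mod h) (kxy_mod h) (r * enat (p ^ \<tau>)) =
            induced kxy (PIdl\<^bsub>kxy\<^esub> h) ` IDer_log const_xy kxy (PIdl\<^bsub>kxy\<^esub> H) r)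
       \<and> leaps (const_mod h) (kxy_mod h) =
            {r * p ^ \<tau> | r. r \<in> leaps (const_mod H) (kxy_mod H)} \<union> {p ^ \<tau>}"
proof -
  define P where "P = p ^ \<tau>"
  have prime: "Factorial_Ring.prime p" using char prime_CHAR_semidom[where 'a = 'k] by simp
  have P1: "P > 1" using prime \<alpha>_pos \<beta>_pos prime_gt_1_nat
    unfolding P_def \<tau>_def by (intro one_less_power) auto
  have "P dvd n" "P dvd q" unfolding P_def \<tau>_def \<alpha>_def \<beta>_def by (auto intro: multiplicity_dvd')
  then have nP: "n = s * P" and qP: "q = t * P" by (simp_all add: s_def t_def P_def)
  have t1: "t \<ge> 1" using nq qP by (cases t) auto
  have st: "\<not> (p dvd s \<and> p dvd t)"
  proof
    assume "p dvd s \<and> p dvd t"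
    then have "p ^ Suc \<tau> dvd n" "p ^ Suc \<tau> dvd q" by (simp_all add: nP qP P_def mult_dvd_mono)
    then have "Suc \<tau> \<le> \<alpha>" "Suc \<tau> \<le> \<beta>"
      unfolding \<alpha>_def \<beta>_def using nq prime
      by (auto intro!: multiplicity_geI simp: prime_nat_iff)
    then show False by (simp add: \<tau>_def)
  qed
  have lc: "lead_coeff H dvd 1" using degree_curve[OF t1 H_def] by simp
  have hH: "h = H ^ P"
    unfolding h_def H_def nP qP power_mult
    by (rule prime_power_char_diff[where k = \<tau>, symmetric]) (use prime char P_def in simp_all)
  have frob: "log_first_components h m = log_first_components H r"
    if "\<And>i. enat (i * P) \<le> m \<longleftrightarrow> enat i \<le> r" for m r
    unfolding hH by (rule log_first_power[where k = \<tau>]) (use prime char P_def lc that in simp_all)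
  \<comment> \<open>At finite lengths below \<open>P\<close> this says that every derivation of \<open>k[x,y]\<close> is \<open>h\<close>-logarithmically integrable.\<close>
  have frob_nat: "log_first_components h (enat m) = log_first_components H (enat (m div P))" for m
    by (rule frob) (use P1 in \<open>simp add: less_eq_div_iff_mult_less_eq\<close>)
  have IDer_h: "IDer (const_mod h) (kxy_mod h) (enat m) =
      induced kxy (PIdl\<^bsub>kxy\<^esub> h) ` log_first_components H (enat (m div P))" if "m \<ge> 1" for m
    using IDer_mod_eq_induced[of "enat m" h] that frob_nat[of m] by (simp add: one_enat_def)
  have "IDer (const_mod h) (kxy_mod h) (r * enat P) =
      induced kxy (PIdl\<^bsub>kxy\<^esub> h) ` IDer_log const_xy kxy (PIdl\<^bsub>kxy\<^esub> H) r" if r: "r \<ge> 1" for r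
  proof -
    have "enat (i * P) \<le> r * enat P \<longleftrightarrow> enat i \<le> r" for i
      using P1 by (cases r) auto
    then have "log_first_components h (r * enat P) = log_first_components H r" by (rule frob)
    moreover have "1 \<le> r * enat P" using r P1 by (cases r) (auto simp: one_enat_def)
    ultimately show ?thesis using IDer_mod_eq_induced IDer_log_eq[OF r] by metis
  qed
  moreover have "leaps (const_mod h) (kxy_mod h) =
      {r * P | r. r \<in> leaps (const_mod H) (kxy_mod H)} \<union> {P}"
  proof -
    \<comment> \<open>The chain \<open>S 0, S 1, \<dots>\<close> is descending, and both leap sets record where it drops.\<close>
    define S where "S r = log_first_components H (enat r)" for r
    have mono: "S r' \<subseteq> S r" if "r \<le> r'" for r r'
      unfolding S_def using that by (intro log_first_antimono) simp
    have leap_h: "m \<in> leaps (const_mod h) (kxy_mod h) \<longleftrightarrow>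
        m > 1 \<and> \<not> S ((m - 1) div P) \<subseteq> S (m div P)" for m
    proof (cases "m > 1")
      case True
      have all: "S r \<subseteq> log_first_components h 1" for r
        using mono[of 0 r] frob_nat[of 1] P1 by (simp add: S_def one_enat_def)
      have Hh: "H dvd h" unfolding hH using P1 by (intro dvd_power) simp
      have "induced kxy (PIdl\<^bsub>kxy\<^esub> h) ` S r \<subseteq> induced kxy (PIdl\<^bsub>kxy\<^esub> h) ` S r' \<longleftrightarrow> S r \<subseteq> S r'" for r r'
        unfolding S_def
        by (rule induced_log_first_subset_iff[OF Hh all[unfolded S_def] all[unfolded S_def]])
      moreover have m1: "IDer (const_mod h) (kxy_mod h) (enat (m - 1)) =
          induced kxy (PIdl\<^bsub>kxy\<^esub> h) ` S ((m - 1) div P)"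
        unfolding S_def by (rule IDer_h) (use True in simp)
      moreover have "S (m div P) \<subseteq> S ((m - 1) div P)" by (intro mono div_le_mono) simp
      ultimately show ?thesis
        using True IDer_h[of m] m1
        by (simp add: leaps_def less_le_not_le image_mono flip: S_def)
    qed (auto simp: leaps_def)
    have leap_H: "r \<in> leaps (const_mod H) (kxy_mod H) \<longleftrightarrow> r > 1 \<and> \<not> S (r - 1) \<subseteq> S r" for r
    proof (cases "r > 1")
      case True
      have all: "S r \<subseteq> log_first_components H 1" if "r \<ge> 1" for r
        using mono[of 1 r] that by (simp add: S_def one_enat_def)
      have "induced kxy (PIdl\<^bsub>kxy\<^esub> H) ` S (r - 1) \<subseteq> induced kxy (PIdl\<^bsub>kxy\<^esub> H) ` S r \<longleftrightarrow> S (r - 1) \<subseteq> S r"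
        unfolding S_def
        by (rule induced_log_first_subset_iff[OF dvd_refl all[unfolded S_def] all[unfolded S_def]])
          (use True in auto)
      moreover have "S r \<subseteq> S (r - 1)" by (intro mono) simp
      moreover have "IDer (const_mod H) (kxy_mod H) (enat r') = induced kxy (PIdl\<^bsub>kxy\<^esub> H) ` S r'"
        if "r' \<ge> 1" for r'
        unfolding S_def by (rule IDer_mod_eq_induced) (use that in \<open>simp add: one_enat_def\<close>)
      then have "IDer (const_mod H) (kxy_mod H) (enat r) = induced kxy (PIdl\<^bsub>kxy\<^esub> H) ` S r"
        "IDer (const_mod H) (kxy_mod H) (enat (r - 1)) = induced kxy (PIdl\<^bsub>kxy\<^esub> H) ` S (r - 1)"
        using True by simp_all
      ultimately show ?thesis using True by (simp add: leaps_def less_le_not_le image_mono)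
    qed (auto simp: leaps_def)
    have leap_1: "\<not> S 0 \<subseteq> S 1"
      using curve_has_non_log_derivation[OF t1 H_def] st char by (simp add: S_def zero_enat_def one_enat_def)
    \<comment> \<open>Passing from \<open>m - 1\<close> to \<open>m\<close> changes the quotient by \<open>P\<close> only if \<open>P\<close> divides \<open>m\<close>.\<close>
    have "m \<in> leaps (const_mod h) (kxy_mod h) \<longleftrightarrow>
        (\<exists>r. m = r * P \<and> (r \<in> leaps (const_mod H) (kxy_mod H) \<or> r = 1))" for m
    proof (cases "P dvd m")
      case True
      then obtain r where m: "m = r * P" by (auto simp: dvd_def mult.commute)
      have "r \<noteq> 0 \<Longrightarrow> (r * P - 1) div P = r - 1"
        using P1 by (cases r) (auto simp: div_mult_self3 algebra_simps intro!: div_nat_eqI)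
      moreover have "r * P > 1 \<longleftrightarrow> r \<ge> 1" using P1 by (cases r) auto
      ultimately have "m \<in> leaps (const_mod h) (kxy_mod h) \<longleftrightarrow> r \<ge> 1 \<and> \<not> S (r - 1) \<subseteq> S r"
        using P1 by (auto simp: leap_h m)
      also have "\<dots> \<longleftrightarrow> r \<in> leaps (const_mod H) (kxy_mod H) \<or> r = 1"
        using leap_1 by (auto simp: leap_H)
      finally show ?thesis using m P1 by auto
    next
      case False
      then have "(m - 1) div P = m div P"
        using div_Suc[of "m - 1" P] by (cases m) (auto simp: dvd_eq_mod_eq_0)
      then show ?thesis using False by (auto simp: leap_h)
    qed
    then show ?thesis by auto
  qed
  ultimately show ?thesis unfolding P_def by blast
qed

end
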